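(* Let $g:\mathbb{R}_+^n\to\mathbb{R}$ be an increasing function, and let $\rho_g:\mathbb{R}_+^n\times\mathbb{R}\to\mathbb{R}_+\cup\{\infty\}$ be its radial inverse, $\rho_g(x,y):=\inf\{r>0: g(x/r)\le y\}$ (with $\inf\emptyset=\infty$). Then $\rho_g$ satisfies the following properties. (i) (Positive-homogeneity in $x$) For all $x\in\mathbb{R}_+^n$, $y\in\mathbb{R}$ and $\alpha>0$, $\rho_g(\alpha x,y)=\alpha\,\rho_g(x,y)$. (ii) (Monotonicity) For all $x,x'\in\mathbb{R}_+^n$ and $y,y'\in\mathbb{R}$: if $x\le x'$ then $\rho_g(x,y)\le\rho_g(x',y)$; and if $y\le y'$ then $\rho_g(x,y')\le\rho_g(x,y)$. (iii) (Right-continuity in $y$) For all $x\in\mathbb{R}_+^n$ and $y\in\mathbb{R}$, $\lim_{\epsilon\downarrow 0}\rho_g(x,y+\epsilon)=\rho_g(x,y)$. (iv) (Well-posedness) For all $x\in\mathbb{R}_+^n$ there exist $y,y'\in\mathbb{R}$ with $y>y'$ such that $\rho_g(x,y)\le 1$ and $\rho_g(x,y')>1$.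
   Context: $\mathbb{R}_+:=[0,\infty)$. For vectors $x,x'\in\mathbb{R}^n$, $x\le x'$ means $x_i\le x'_i$ for all $i\in\{1,\dots,n\}$. A function $g:\mathbb{R}_+^n\to\mathbb{R}$ is increasing if $g(x)\le g(x')$ whenever $x\le x'$ (no continuity or strictness is assumed). Values of $\rho_g$ lie in $[0,\infty]$; order, limits and multiplication by $\alpha>0$ are understood in the extended sense (in particular $\alpha\cdot\infty=\infty$). *)

theory Defs
  imports "HOL-Analysis.Analysis"
begin

(* Values in [0,\<infinity>] are rendered in ennreal, where Inf {} = \<infinity>.
   The order on real ^ 'n is the componentwise one, so {0..} is the nonnegative orthant.
   For x in the orthant and r > 0 the point x /\<^sub>R r stays in the orthant, so values of g
   outside of it play no role. *)
definition radial_inverse :: "(real ^ 'n \<Rightarrow> real) \<Rightarrow> real ^ 'n \<Rightarrow> real \<Rightarrow> ennreal" where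
  "radial_inverse g x y = Inf {ennreal r | r. r > 0 \<and> g (x /\<^sub>R r) \<le> y}"

end

theory Submission
  imports Defs
begin

text \<open>Call \<open>r > 0\<close> admissible for \<open>x\<close> and \<open>y\<close> if
  \<open>g (x /\<^sub>R r) \<le> y\<close>; the radial inverse is the infimum of the admissible
  radii. Scaling \<open>x\<close> scales this set, and monotonicity in \<open>x\<close> or
  \<open>y\<close> is inclusion of such sets. For the other two properties the point is that
  \<open>g\<close> decreases in \<open>r\<close> along the ray \<open>x /\<^sub>R r\<close>
  (\<open>ray_antimono\<close>), so the admissible set is upward closed and every inadmissible
  radius bounds it from below (\<open>radial_inverse_ge\<close>). Inadmissibility is the strict
  inequality \<open>y < g (x /\<^sub>R r)\<close>, which survives a small increase of
  \<open>y\<close>: hence right-continuity.\<close>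

lemma radial_inverse_le:
  assumes "r > 0" "g (x /\<^sub>R r) \<le> y"
  shows "radial_inverse g x y \<le> ennreal r"
  unfolding radial_inverse_def using assms by (intro Inf_lower) auto

lemma le_radial_inverseI:
  assumes "\<And>r. r > 0 \<Longrightarrow> g (x /\<^sub>R r) \<le> y \<Longrightarrow> c \<le> ennreal r"
  shows "c \<le> radial_inverse g x y"
  unfolding radial_inverse_def using assms by (intro Inf_greatest) auto

lemma radial_inverse_antimono:
  assumes "y \<le> y'"
  shows "radial_inverse g x y' \<le> radial_inverse g x y"
  using assms by (intro le_radial_inverseI radial_inverse_le) auto

text \<open>The radius \<open>r\<close> is admissible for \<open>\<alpha> *\<^sub>R x\<close>
  exactly when \<open>r / \<alpha>\<close> is admissible for \<open>x\<close>. One inequality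
  suffices, since the factor \<alpha> is arbitrary and can be inverted.\<close>

lemma scaled_radial_inverse_le:
  assumes "\<alpha> > 0"
  shows "ennreal \<alpha> * radial_inverse g x y \<le> radial_inverse g (\<alpha> *\<^sub>R x) y"
proof (rule le_radial_inverseI)
  fix r :: real assume r: "r > 0" "g ((\<alpha> *\<^sub>R x) /\<^sub>R r) \<le> y"
  have "radial_inverse g x y \<le> ennreal (r / \<alpha>)"
    using assms r by (intro radial_inverse_le) (simp_all add: field_simps)
  then have "ennreal \<alpha> * radial_inverse g x y \<le> ennreal \<alpha> * ennreal (r / \<alpha>)"
    by (intro mult_left_mono) auto
  also have "\<dots> = ennreal r"
    using assms r by (simp flip: ennreal_mult)
  finally show "ennreal \<alpha> * radial_inverse g x y \<le> ennreal r" .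
qed

lemma radial_inverse_scaleR:
  assumes "\<alpha> > 0"
  shows "radial_inverse g (\<alpha> *\<^sub>R x) y = ennreal \<alpha> * radial_inverse g x y"
proof (rule antisym)
  \<comment> \<open>The inequality just proved, now with factor \<open>1 / \<alpha>\<close> at the
    point \<open>\<alpha> *\<^sub>R x\<close>; multiplying by \<alpha> gives the reverse
    bound.\<close>
  have "ennreal (1 / \<alpha>) * radial_inverse g (\<alpha> *\<^sub>R x) y
      \<le> radial_inverse g ((1 / \<alpha>) *\<^sub>R \<alpha> *\<^sub>R x) y"
    using assms by (intro scaled_radial_inverse_le) simp
  also have "(1 / \<alpha>) *\<^sub>R \<alpha> *\<^sub>R x = x"
    using assms by simp
  finally have "ennreal \<alpha> * (ennreal (1 / \<alpha>) * radial_inverse g (\<alpha> *\<^sub>R x) y)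
      \<le> ennreal \<alpha> * radial_inverse g x y"
    by (intro mult_left_mono) auto
  moreover have "ennreal \<alpha> * ennreal (1 / \<alpha>) = 1"
    using assms by (simp flip: ennreal_mult)
  ultimately show "radial_inverse g (\<alpha> *\<^sub>R x) y \<le> ennreal \<alpha> * radial_inverse g x y"
    by (simp flip: mult.assoc)
qed (rule scaled_radial_inverse_le[OF assms])

lemma scaleR_nonneg_vec:
  fixes x :: "real ^ 'n"
  assumes "0 \<le> c" "0 \<le> x"
  shows "0 \<le> c *\<^sub>R x"
  using assms by (simp add: less_eq_vec_def)

lemma radial_inverse_mono:
  fixes g :: "real ^ 'n \<Rightarrow> real"
  assumes "mono_on {0..} g" "0 \<le> x" "x \<le> x'"
  shows "radial_inverse g x y \<le> radial_inverse g x' y"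
proof (intro le_radial_inverseI radial_inverse_le)
  fix r :: real assume r: "r > 0" "g (x' /\<^sub>R r) \<le> y"
  have "x /\<^sub>R r \<le> x' /\<^sub>R r"
    using r assms(3) by (auto simp: less_eq_vec_def intro: mult_left_mono)
  moreover have "0 \<le> x /\<^sub>R r"
    using r assms(2) by (intro scaleR_nonneg_vec) auto
  ultimately have "g (x /\<^sub>R r) \<le> g (x' /\<^sub>R r)"
    by (intro mono_onD[OF assms(1)]) auto
  with r show "g (x /\<^sub>R r) \<le> y" by simp
qed

lemma ray_antimono:
  fixes g :: "real ^ 'n \<Rightarrow> real"
  assumes "mono_on {0..} g" "0 \<le> x" "0 < s" "s \<le> r"
  shows "g (x /\<^sub>R r) \<le> g (x /\<^sub>R s)"
proof (rule mono_onD[OF assms(1)])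
  show "x /\<^sub>R r \<in> {0..}" "x /\<^sub>R s \<in> {0..}"
    using assms by (auto intro!: scaleR_nonneg_vec)
  show "x /\<^sub>R r \<le> x /\<^sub>R s"
    using assms by (auto simp: less_eq_vec_def intro!: mult_right_mono le_imp_inverse_le)
qed

text \<open>An admissible \<open>s \<le> r\<close> would give
  \<open>g (x /\<^sub>R r) \<le> g (x /\<^sub>R s) \<le> y\<close>, so all admissible radii exceed
  \<open>r\<close>.\<close>

lemma radial_inverse_ge:
  fixes g :: "real ^ 'n \<Rightarrow> real"
  assumes "mono_on {0..} g" "0 \<le> x" "y < g (x /\<^sub>R r)"
  shows "ennreal r \<le> radial_inverse g x y"
proof (rule le_radial_inverseI)
  fix s :: real assume s: "s > 0" "g (x /\<^sub>R s) \<le> y"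
  then have "\<not> s \<le> r"
    using ray_antimono[OF assms(1,2), of s r] assms(3) by auto
  then show "ennreal r \<le> ennreal s" by (simp add: ennreal_leI)
qed

lemma radial_inverse_right_continuous:
  fixes g :: "real ^ 'n \<Rightarrow> real"
  assumes "mono_on {0..} g" "0 \<le> x"
  shows "((\<lambda>\<epsilon>. radial_inverse g x (y + \<epsilon>)) \<longlongrightarrow> radial_inverse g x y) (at_right 0)"
proof (rule order_tendstoI)
  fix a assume "a < radial_inverse g x y"
  \<comment> \<open>A value strictly between is needed: \<open>c\<close> lies below the infimum,
    hence is a finite, inadmissible radius, and the slack \<open>a < c\<close> keeps the final
    inequality strict and makes the radius positive.\<close>
  then obtain c where c: "a < c" "c < radial_inverse g x y"
    using dense by blast
  then obtain r where r: "c = ennreal r" "0 \<le> r"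
    by (cases c) auto
  have "0 < r" using c r by (cases "r = 0") auto
  then have y: "y < g (x /\<^sub>R r)"
    using radial_inverse_le[of r g x y] c(2) r(1) by (auto simp: not_le[symmetric])
  \<comment> \<open>While \<epsilon> stays below this gap, \<open>r\<close> remains inadmissible at
    level \<open>y + \<epsilon>\<close>.\<close>
  have "\<forall>\<^sub>F \<epsilon> in at_right 0. \<epsilon> < g (x /\<^sub>R r) - y"
    using y by (intro order_tendstoD(2)[OF tendsto_ident_at]) simp
  then show "\<forall>\<^sub>F \<epsilon> in at_right 0. a < radial_inverse g x (y + \<epsilon>)"
  proof eventually_elim
    case (elim \<epsilon>)
    then have "c \<le> radial_inverse g x (y + \<epsilon>)"
      unfolding r(1) by (intro radial_inverse_ge assms) simp
    with c(1) show ?case by simp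
  qed
next
  \<comment> \<open>The upper half is only antitonicity in \<open>y\<close>, as \<epsilon> is
    positive.\<close>
  fix a assume a: "radial_inverse g x y < a"
  show "\<forall>\<^sub>F \<epsilon> in at_right 0. radial_inverse g x (y + \<epsilon>) < a"
    using eventually_at_right_less
  proof eventually_elim
    case (elim \<epsilon>)
    then show ?case
      using a radial_inverse_antimono[of y "y + \<epsilon>" g x] by simp
  qed
qed

lemma radial_inverse_well_posed:
  fixes g :: "real ^ 'n \<Rightarrow> real"
  assumes "mono_on {0..} g" "0 \<le> x"
  shows "\<exists>y y'. y > y' \<and> radial_inverse g x y \<le> 1 \<and> radial_inverse g x y' > 1"
proof (intro exI conjI)
  \<comment> \<open>The level \<open>g x\<close> makes radius 1 admissible. Subtracting 1 from
    \<open>g (x /\<^sub>R 2)\<close> makes radius 2 inadmissible, which pushes the infimum up to at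
    least 2.\<close>
  show "g (x /\<^sub>R 2) - 1 < g x"
    using ray_antimono[OF assms, of 1 2] by simp
  show "radial_inverse g x (g x) \<le> 1"
    using radial_inverse_le[of 1 g x "g x"] by simp
  have "1 < ennreal 2" by simp
  also have "ennreal 2 \<le> radial_inverse g x (g (x /\<^sub>R 2) - 1)"
    by (intro radial_inverse_ge assms) simp
  finally show "1 < radial_inverse g x (g (x /\<^sub>R 2) - 1)" .
qed

theorem proposition1:
  fixes g :: "real ^ 'n \<Rightarrow> real"
  assumes "mono_on {0..} g"
  shows
    "(\<forall>x\<in>{0..}. \<forall>y. \<forall>\<alpha>>0.
        radial_inverse g (\<alpha> *\<^sub>R x) y = ennreal \<alpha> * radial_inverse g x y) \<and>
     (\<forall>x\<in>{0..}. \<forall>x'\<in>{0..}. \<forall>y y'.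
        (x \<le> x' \<longrightarrow> radial_inverse g x y \<le> radial_inverse g x' y) \<and>
        (y \<le> y' \<longrightarrow> radial_inverse g x y' \<le> radial_inverse g x y)) \<and>
     (\<forall>x\<in>{0..}. \<forall>y.
        ((\<lambda>\<epsilon>. radial_inverse g x (y + \<epsilon>)) \<longlongrightarrow> radial_inverse g x y) (at_right 0)) \<and>
     (\<forall>x\<in>{0..}. \<exists>y y'.
        y > y' \<and> radial_inverse g x y \<le> 1 \<and> radial_inverse g x y' > 1)"
  using assms by (auto intro: radial_inverse_scaleR radial_inverse_mono radial_inverse_antimono
    radial_inverse_right_continuous radial_inverse_well_posed)

end
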